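(* Let $K\subseteq\mathbb{R}^n$ be a symmetric convex body, $\mathcal{L}\subseteq\mathbb{R}^n$ an $n$-dimensional lattice, and $t\ge0$. Let $N=|tK\cap\mathcal{L}|$, and let $p$ be a prime satisfying $N<p<\frac{4N}{3}$ if $N>1000$, and $p=3$ otherwise. Then there exists $\mathbf{w}\in\mathcal{L}^*$ such that the sublattice $\mathcal{L}(\mathbf{w})=\{\mathbf{y}\in\mathcal{L}:\langle\mathbf{w},\mathbf{y}\rangle\equiv0\pmod p\}$ satisfies (1) for all $\mathbf{x}\in\mathbb{R}^n$, $d_K(\mathcal{L}(\mathbf{w}),\mathbf{x})\le d_K(\mathcal{L},\mathbf{x})+3t$, and (2) $G(3tK,\mathcal{L}(\mathbf{w}))\le 1000\cdot7^n$.
   Context: A convex body is a full-dimensional compact convex set; it is symmetric if $K=-K$. $\|\mathbf{x}\|_K=\inf\{s\ge0:\mathbf{x}\in sK\}$. An $n$-dimensional lattice is $B\mathbb{Z}^n$ for a nonsingular $B\in\mathbb{R}^{n\times n}$; its dual is $\mathcal{L}^*=\{\mathbf{y}\in\mathbb{R}^n:\langle\mathbf{x},\mathbf{y}\rangle\in\mathbb{Z}\ \forall\mathbf{x}\in\mathcal{L}\}$. $d_K(\mathcal{L},\mathbf{x})=\min_{\mathbf{y}\in\mathcal{L}}\|\mathbf{y}-\mathbf{x}\|_K$, and $G(A,\mathcal{L})=\max_{\mathbf{x}\in\mathbb{R}^n}|(A+\mathbf{x})\cap\mathcal{L}|$. *)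

theory Defs
  imports
    "HOL-Analysis.Analysis"
    "HOL-Number_Theory.Cong"
    "HOL-Library.Extended_Nat"
begin

definition convex_body :: "'a::euclidean_space set \<Rightarrow> bool" where
  "convex_body K \<longleftrightarrow> convex K \<and> compact K \<and> aff_dim K = int DIM('a)"

definition symmetric_set :: "'a::euclidean_space set \<Rightarrow> bool" where
  "symmetric_set K \<longleftrightarrow> K = uminus ` K"

text \<open>For a symmetric convex body the infimum is over a nonempty set that is bounded below.\<close>

definition norm_of_body :: "'a::euclidean_space set \<Rightarrow> 'a \<Rightarrow> real" where
  "norm_of_body K x = Inf {s. 0 \<le> s \<and> x \<in> (\<lambda>v. s *\<^sub>R v) ` K}"

definition full_lattice :: "(real ^ 'n) set \<Rightarrow> bool" where
  "full_lattice L \<longleftrightarrow>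
     (\<exists>B :: real ^ 'n ^ 'n. invertible B \<and> L = (\<lambda>z. B *v z) ` {z. \<forall>i. z $ i \<in> \<int>})"

definition dual_lattice :: "'a::euclidean_space set \<Rightarrow> 'a set" where
  "dual_lattice L = {y. \<forall>x\<in>L. x \<bullet> y \<in> \<int>}"

text \<open>The minimum over \<open>L\<close> is written as an infimum; for a lattice \<open>L\<close> and a symmetric convex
  body \<open>K\<close> it is attained, since each ball contains only finitely many lattice points.\<close>

definition body_dist :: "'a::euclidean_space set \<Rightarrow> 'a set \<Rightarrow> 'a \<Rightarrow> real" where
  "body_dist K L x = (INF y\<in>L. norm_of_body K (y - x))"

text \<open>The maximum is taken in \<^typ>\<open>enat\<close>, with infinite intersections counted as \<open>\<infinity>\<close>, so that an
  upper bound on \<open>max_translate_points\<close> also asserts finiteness of all the intersections (the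
  cardinality \<^const>\<open>card\<close> of an infinite set would be 0). A supremum in \<^typ>\<open>enat\<close> of a
  nonempty set is attained whenever it is finite.\<close>

definition max_translate_points :: "'a::euclidean_space set \<Rightarrow> 'a set \<Rightarrow> enat" where
  "max_translate_points A L =
     (SUP x. let S = (\<lambda>a. a + x) ` A \<inter> L in if finite S then enat (card S) else \<infinity>)"

text \<open>For \<open>w\<close> in the dual lattice the inner product is always an integer, so the first conjunct only
  names that integer.\<close>

definition congruence_sublattice ::
    "nat \<Rightarrow> 'a::euclidean_space set \<Rightarrow> 'a \<Rightarrow> 'a set" where
  "congruence_sublattice p L w =
     {y \<in> L. \<exists>k::int. w \<bullet> y = of_int k \<and> [k = 0] (mod int p)}"

end

theory Submission
  imports Defs
begin

text \<open>
  For \<open>N \<le> 1000\<close> take \<open>w = 0\<close>. For \<open>N > 1000\<close> the points of \<open>tK \<inter> L\<close> are pairwise distinct modulo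
  \<open>p L\<close>. Draw \<open>w\<close> uniformly from \<open>L*\<close> modulo \<open>p L*\<close>: a given nonzero vector of \<open>L / p L\<close> is orthogonal
  to \<open>w\<close> modulo \<open>p\<close> with probability \<open>1 / p\<close>. Averaging a weighted sum of the number of nonzero points of
  \<open>tK \<inter> L(w)\<close> and the number of pairs of \<open>tK \<inter> L\<close> with the same residue \<open>\<langle>w, y\<rangle>\<close> yields one \<open>w\<close>
  with \<open>card (tK \<inter> L(w)) \<le> 1000\<close> and at least \<open>(p + 2) / 3\<close> residues \<open>\<langle>w, y\<rangle>\<close>, \<open>y \<in> tK \<inter> L\<close>.
  By Cauchy--Davenport sums of three such residues cover everything, so that each point of \<open>L\<close> can be
  moved into \<open>L(w)\<close> by a vector of \<open>3tK\<close>, which is (1). For (2), a maximal subset of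
  \<open>(3tK + x) \<inter> L(w)\<close> with differences outside \<open>tK\<close> has at most \<open>7 ^ n\<close> points by a volume
  argument, and its translates by \<open>tK \<inter> L(w)\<close> cover \<open>(3tK + x) \<inter> L(w)\<close>.
\<close>

section \<open>Sumsets modulo a prime\<close>

lemma inj_on_add_mod:
  fixes p e :: int
  assumes "A \<subseteq> {0..<p}"
  shows "inj_on (\<lambda>x. (x + e) mod p) A"
proof (rule inj_onI)
  fix x y assume "x \<in> A" "y \<in> A" "(x + e) mod p = (y + e) mod p"
  moreover from this have "p dvd x - y"
    by (simp add: mod_eq_dvd_iff)
  ultimately have "x mod p = y mod p" "x \<in> {0..<p}" "y \<in> {0..<p}"
    using assms by (auto simp: mod_eq_dvd_iff)
  then show "x = y" by simp
qed

text \<open>Since \<open>p\<close> is prime and does not divide \<open>d\<close>, \<open>d\<close>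
  is invertible modulo \<open>p\<close>, so the orbit \<open>a, a + d, a + 2 * d, ...\<close> of a
  single element already runs through every residue.\<close>

lemma translation_closed_residues:
  fixes p d :: int
  assumes "prime p" "A \<subseteq> {0..<p}" "A \<noteq> {}" "\<not> p dvd d"
    and closed: "\<And>a. a \<in> A \<Longrightarrow> (a + d) mod p \<in> A"
  shows "A = {0..<p}"
proof
  obtain a where a: "a \<in> A" using assms by blast
  have step: "(a + int k * d) mod p \<in> A" for k
  proof (induction k)
    case 0
    then show ?case using a assms(2) by auto
  next
    case (Suc k)
    have "((a + int k * d) mod p + d) mod p = (a + int (Suc k) * d) mod p"
      by (simp add: mod_simps algebra_simps)
    then show ?case using closed[OF Suc] by simp
  qed
  show "{0..<p} \<subseteq> A"
  proof
    fix r assume r: "r \<in> {0..<p}"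
    have "coprime d p"
      using assms(1,4) by (metis coprime_commute prime_imp_coprime)
    then obtain x where x: "[d * x = 1] (mod p)"
      using cong_solve_coprime_int by blast
    \<comment> \<open>The number of steps from \<open>a\<close> to \<open>r\<close> is
      \<open>(r - a) / d\<close> modulo \<open>p\<close>. It is reduced to a natural number because
      \<open>step\<close> was proved by induction on \<open>k\<close>.\<close>
    define k where "k = nat ((x * (r - a)) mod p)"
    have p: "p > 0" using assms(1) prime_gt_0_int by blast
    have "[int k = x * (r - a)] (mod p)"
      using p by (simp add: k_def cong_def)
    then have "[a + int k * d = a + x * (r - a) * d] (mod p)"
      by (intro cong_add cong_mult) auto
    also have "a + x * (r - a) * d = a + (d * x) * (r - a)"
      by simp
    also have "[a + (d * x) * (r - a) = a + 1 * (r - a)] (mod p)"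
      using x by (intro cong_add cong_mult) auto
    finally have "(a + int k * d) mod p = r"
      using r by (simp add: cong_def)
    then show "r \<in> A" using step[of k] by simp
  qed
qed (use assms in auto)

text \<open>Dyson's e-transform: replace \<open>A\<close> by its union with the shift
  \<open>B + e\<close>, and \<open>B\<close> by the part of \<open>B\<close> that the shift sends
  into \<open>A\<close>. This preserves \<open>card A + card B\<close>, does not enlarge the sumset,
  and for a suitable \<open>e\<close> makes \<open>B\<close> strictly smaller but nonempty.\<close>

theorem Cauchy_Davenport:
  fixes p :: int
  assumes "prime p" "A \<subseteq> {0..<p}" "B \<subseteq> {0..<p}" "A \<noteq> {}" "B \<noteq> {}"
  shows "min (nat p) (card A + card B - 1) \<le> card ((\<lambda>(a, b). (a + b) mod p) ` (A \<times> B))"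
  using assms(2-)
proof (induction "card B" arbitrary: A B rule: less_induct)
  case less
  let ?S = "\<lambda>A B. (\<lambda>(a, b). (a + b) mod p) ` (A \<times> B)"
  have fin: "finite A" "finite B"
    using less.prems by (auto intro: finite_subset)
  have finS: "finite (?S A B)" using fin by simp
  obtain b' where b': "b' \<in> B" using less.prems by blast
  have "card A = card ((\<lambda>a. (a + b') mod p) ` A)"
    by (rule card_image[symmetric]) (rule inj_on_add_mod[OF less.prems(1)])
  also have "\<dots> \<le> card (?S A B)"
    using b' by (intro card_mono finS) force
  finally have cA: "card A \<le> card (?S A B)" .
  show ?case
  proof (cases "card B = 1 \<or> A = {0..<p}")
    case True
    then show ?thesis using cA by auto
  next
    case False
    then obtain b where b: "b \<in> B" "b \<noteq> b'"
      by (metis b' card_1_singleton_iff insert_absorb insert_not_empty subsetI subset_singletonD singletonI subset_antisym One_nat_def)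
    have "\<not> p dvd b - b'"
    proof
      assume "p dvd b - b'"
      then have "b mod p = b' mod p" by (simp add: mod_eq_dvd_iff)
      moreover have "b \<in> {0..<p}" "b' \<in> {0..<p}" using b b' less.prems(2) by auto
      ultimately show False using b by simp
    qed
    \<comment> \<open>\<open>A\<close> is nonempty and not everything, so it is not closed under
      translation by \<open>b - b'\<close>. With \<open>e = a - b'\<close> the shift sends
      \<open>b'\<close> to \<open>a\<close> in \<open>A\<close>, but \<open>b\<close> outside
      \<open>A\<close>; hence \<open>b'\<close> survives in \<open>B'\<close> and \<open>b\<close>
      does not.\<close>
    then obtain a where a: "a \<in> A" "(a + (b - b')) mod p \<notin> A"
      using translation_closed_residues[OF assms(1) less.prems(1,3)] False by blast
    define e where "e = a - b'"
    let ?h = "\<lambda>x. (x + e) mod p"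
    define A' where "A' = A \<union> ?h ` B"
    define B' where "B' = {x \<in> B. ?h x \<in> A}"
    have p: "p > 0" using assms(1) prime_gt_0_int by blast
    have A': "A' \<subseteq> {0..<p}" "A' \<noteq> {}"
      using less.prems p by (auto simp: A'_def)
    have "b' \<in> B'"
      using a b' less.prems(1) by (auto simp: B'_def e_def)
    moreover have "b \<notin> B'"
      using a(2) by (auto simp: B'_def e_def algebra_simps)
    ultimately have B': "B' \<subseteq> B" "B' \<subset> B" "B' \<noteq> {}"
      using b by (auto simp: B'_def)
    have "card B' < card B"
      using B' fin by (simp add: psubset_card_mono)
    then have IH: "min (nat p) (card A' + card B' - 1) \<le> card (?S A' B')"
      using A' B' less.prems by (intro less.hyps) auto
    have "A \<inter> ?h ` B = ?h ` B'"
      by (auto simp: B'_def)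
    moreover have "card (?h ` B') = card B'" "card (?h ` B) = card B"
      using B' less.prems(2) by (auto intro!: card_image inj_on_add_mod)
    ultimately have "card A' + card B' = card A + card B"
      using card_Un_Int[of A "?h ` B"] fin by (simp add: A'_def)
    moreover have "?S A' B' \<subseteq> ?S A B"
    proof clarify
      fix x y assume x: "x \<in> A'" and y: "y \<in> B'"
      show "(x + y) mod p \<in> ?S A B"
      proof (cases "x \<in> A")
        case True
        then show ?thesis using y B' by force
      next
        case False
        then obtain c where c: "c \<in> B" "x = ?h c" using x by (auto simp: A'_def)
        \<comment> \<open>The shift \<open>e\<close> is moved from \<open>c\<close> to
          \<open>y\<close>; the shifted \<open>y\<close> lies in \<open>A\<close> because
          \<open>y\<close> is in \<open>B'\<close>, and \<open>c\<close> is in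
          \<open>B\<close>.\<close>
        have "(x + y) mod p = (?h y + c) mod p"
          by (simp add: c mod_simps algebra_simps)
        then show ?thesis using c y by (force simp: B'_def)
      qed
    qed
    then have "card (?S A' B') \<le> card (?S A B)"
      by (rule card_mono[OF finS])
    ultimately show ?thesis using IH by simp
  qed
qed

text \<open>Two applications of Cauchy-Davenport bound the threefold sumset below by
  \<open>min p (3 * card A - 2)\<close>, which is where the \<open>+ 2\<close> in the hypothesis
  comes from.\<close>

lemma triple_sumset_residues:
  fixes p r :: int
  assumes "prime p" "A \<subseteq> {0..<p}" "nat p + 2 \<le> 3 * card A"
  obtains a b c where "a \<in> A" "b \<in> A" "c \<in> A" "(a + b + c) mod p = r mod p"
proof -
  let ?S = "\<lambda>A B. (\<lambda>(a, b). (a + b) mod p) ` (A \<times> B)"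
  have p: "p > 0" using assms(1) prime_gt_0_int by blast
  have ne: "A \<noteq> {}" using assms(3) by auto
  have sub: "?S X Y \<subseteq> {0..<p}" for X Y using p by auto
  have "min (nat p) (card A + card A - 1) \<le> card (?S A A)"
    using assms ne by (intro Cauchy_Davenport)
  moreover have "min (nat p) (card (?S A A) + card A - 1) \<le> card (?S (?S A A) A)"
    using assms ne sub by (intro Cauchy_Davenport) auto
  ultimately have "nat p \<le> card (?S (?S A A) A)"
    using assms(3) by linarith
  then have "?S (?S A A) A = {0..<p}"
    using sub[of "?S A A" A] by (intro card_seteq) auto
  moreover have "r mod p \<in> {0..<p}" using p by simp
  ultimately have "r mod p \<in> ?S (?S A A) A" by simp
  then obtain a b c where "a \<in> A" "b \<in> A" "c \<in> A" "r mod p = ((a + b) mod p + c) mod p"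
    by auto
  then show thesis using that[of a b c] by (simp add: mod_simps)
qed

section \<open>Random linear forms modulo a prime\<close>

text \<open>Shifting coordinate \<open>i\<close> of an orthogonal \<open>u\<close> by each
  \<open>k\<close> in \<open>{0..<p}\<close> gives \<open>p\<close> vectors of \<open>U\<close>.
  Vectors from different pairs \<open>(k, u)\<close> are different, so at most a fraction
  \<open>1 / p\<close> of \<open>U\<close> is orthogonal to \<open>z\<close>.\<close>

lemma card_orthogonal_residue_vectors:
  fixes p :: int and z :: "'n::finite \<Rightarrow> int"
  defines "U \<equiv> PiE UNIV (\<lambda>_. {0..<p})"
  assumes "prime p" "\<not> p dvd z i"
  shows "nat p * card {u \<in> U. p dvd (\<Sum>j\<in>UNIV. u j * z j)} \<le> card U"
proof -
  let ?O = "{u \<in> U. p dvd (\<Sum>j\<in>UNIV. u j * z j)}"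
  let ?g = "\<lambda>(k, u). u(i := (u i + k) mod p)"
  have p: "p > 0" using assms(2) prime_gt_0_int by blast
  have finU: "finite U" unfolding U_def by (intro finite_PiE) auto
  have dot: "(\<Sum>j\<in>UNIV. (u(i := (u i + k) mod p)) j * z j) mod p
      = ((\<Sum>j\<in>UNIV. u j * z j) + k * z i) mod p" for u k
  proof -
    have "(\<Sum>j\<in>UNIV. (u(i := (u i + k) mod p)) j * z j)
        = (\<Sum>j\<in>UNIV - {i}. u j * z j) + (u i + k) mod p * z i"
      by (subst sum.remove[of _ i]) (auto intro!: sum.cong)
    moreover have "(\<Sum>j\<in>UNIV. u j * z j) = (\<Sum>j\<in>UNIV - {i}. u j * z j) + u i * z i"
      by (subst sum.remove[of _ i]) auto
    moreover have "((\<Sum>j\<in>UNIV - {i}. u j * z j) + (u i + k) mod p * z i) mod p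
        = ((\<Sum>j\<in>UNIV - {i}. u j * z j) + (u i + k) * z i) mod p"
      by (rule mod_add_cong[OF refl]) (rule mod_mult_left_eq)
    ultimately show ?thesis by (simp add: algebra_simps)
  qed
  \<comment> \<open>Modulo \<open>p\<close> the shifted vector has product \<open>k * z i\<close>
    with \<open>z\<close>. As \<open>z i\<close> is invertible this determines \<open>k\<close>, and
    then \<open>u\<close> is recovered by undoing the shift.\<close>
  have "inj_on ?g ({0..<p} \<times> ?O)"
  proof (rule inj_onI, clarify)
    fix k u l v
    assume k: "k \<in> {0..<p}" and l: "l \<in> {0..<p}" and u: "u \<in> U" and v: "v \<in> U"
      and ou: "p dvd (\<Sum>j\<in>UNIV. u j * z j)" and ov: "p dvd (\<Sum>j\<in>UNIV. v j * z j)"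
      and eq: "u(i := (u i + k) mod p) = v(i := (v i + l) mod p)"
    have *: "((\<Sum>j\<in>UNIV. u j * z j) + k * z i) mod p = ((\<Sum>j\<in>UNIV. v j * z j) + l * z i) mod p"
      using dot[of u k] dot[of v l] eq by simp
    have "p dvd ((\<Sum>j\<in>UNIV. u j * z j) + k * z i) - ((\<Sum>j\<in>UNIV. v j * z j) + l * z i)"
      using * by (simp only: mod_eq_dvd_iff)
    also have "\<dots> = ((\<Sum>j\<in>UNIV. u j * z j) - (\<Sum>j\<in>UNIV. v j * z j)) + (k - l) * z i"
      by (simp add: algebra_simps)
    finally have "p dvd (k - l) * z i"
      using ou ov by (meson dvd_add_right_iff dvd_diff)
    then have "p dvd k - l"
      using assms(2,3) prime_dvd_mult_iff by blast
    then have "k mod p = l mod p" by (simp only: mod_eq_dvd_iff)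
    then have kl: "k = l" using k l by simp
    have "(u i + k) mod p = (v i + k) mod p"
      using fun_cong[OF eq, of i] kl by simp
    moreover have "u i \<in> {0..<p}" "v i \<in> {0..<p}"
      using u v by (auto simp: U_def)
    ultimately have "u i = v i"
      by (rule inj_onD[OF inj_on_add_mod[OF order_refl]])
    moreover have "u j = v j" if "j \<noteq> i" for j
      using fun_cong[OF eq, of j] that by simp
    ultimately show "k = l \<and> u = v" using kl by (metis ext)
  qed
  moreover have "?g ` ({0..<p} \<times> ?O) \<subseteq> U"
    using p by (auto simp: U_def PiE_def Pi_def)
  ultimately have "card ({0..<p} \<times> ?O) \<le> card U"
    using finU by (rule card_inj_on_le)
  then show ?thesis by (simp add: card_cartesian_product)
qed

text \<open>First moment method over all \<open>u\<close> with entries in \<open>{0..<p}\<close>: if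
  every such \<open>u\<close> exceeded the bound, so would the average, contradicting the fraction
  \<open>1 / p\<close> for each \<open>z k\<close>. The weights \<open>c\<close> allow several
  counts to be controlled by one \<open>u\<close>.\<close>

lemma exists_residue_vector_few_orthogonal:
  fixes p :: int and z :: "'i \<Rightarrow> 'n::finite \<Rightarrow> int" and c :: "'i \<Rightarrow> real"
  assumes "prime p" "finite I" "\<And>k. k \<in> I \<Longrightarrow> \<exists>i. \<not> p dvd z k i" "\<And>k. k \<in> I \<Longrightarrow> c k \<ge> 0"
  shows "\<exists>u. p * (\<Sum>k\<in>I. c k * of_bool (p dvd (\<Sum>j\<in>UNIV. u j * z k j))) \<le> sum c I"
proof (rule ccontr)
  let ?U = "PiE UNIV (\<lambda>_. {0..<p}) :: ('n \<Rightarrow> int) set"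
  let ?o = "\<lambda>u k. of_bool (p dvd (\<Sum>j\<in>UNIV. u j * z k j)) :: real"
  have p: "p > 0" using assms(1) prime_gt_0_int by blast
  have finU: "finite ?U" by (intro finite_PiE) auto
  have neU: "?U \<noteq> {}" using p by (simp add: PiE_eq_empty_iff)
  assume "\<not> ?thesis"
  then have "(\<Sum>u\<in>?U. sum c I) < (\<Sum>u\<in>?U. p * (\<Sum>k\<in>I. c k * ?o u k))"
    using finU neU by (intro sum_strict_mono) (auto simp: not_le)
  also have "\<dots> = (\<Sum>u\<in>?U. \<Sum>k\<in>I. c k * (p * ?o u k))"
    by (simp add: sum_distrib_left mult_ac)
  also have "\<dots> = (\<Sum>k\<in>I. \<Sum>u\<in>?U. c k * (p * ?o u k))"
    by (rule sum.swap)
  also have "\<dots> = (\<Sum>k\<in>I. c k * (p * (\<Sum>u\<in>?U. ?o u k)))"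
    by (simp add: sum_distrib_left)
  also have "\<dots> \<le> (\<Sum>k\<in>I. c k * card ?U)"
  proof (intro sum_mono mult_left_mono)
    fix k assume k: "k \<in> I"
    obtain i where "\<not> p dvd z k i" using assms(3)[OF k] by blast
    then have "nat p * card {u \<in> ?U. p dvd (\<Sum>j\<in>UNIV. u j * z k j)} \<le> card ?U"
      by (rule card_orthogonal_residue_vectors[OF assms(1)])
    then have "real (nat p) * real (card {u \<in> ?U. p dvd (\<Sum>j\<in>UNIV. u j * z k j)}) \<le> real (card ?U)"
      unfolding of_nat_mult[symmetric] of_nat_le_iff .
    moreover have "(\<Sum>u\<in>?U. ?o u k) = real (card {u \<in> ?U. p dvd (\<Sum>j\<in>UNIV. u j * z k j)})"
      using finU by (simp add: of_bool_def sum.If_cases Int_def)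
    ultimately show "p * (\<Sum>u\<in>?U. ?o u k) \<le> card ?U"
      using p by simp
  qed (use assms(4) in auto)
  also have "\<dots> = (\<Sum>u\<in>?U. sum c I)"
    by (simp add: sum_distrib_right mult.commute)
  finally show False by simp
qed

text \<open>A fibre with \<open>m > 0\<close> points contributes one value and
  \<open>m * (m - 1)\<close> ordered collisions, and \<open>2 * m <= 2 + m * (m - 1)\<close>. In the
  induction, a new point brings either a new value or at least the two ordered pairs with an earlier
  point.\<close>

lemma card_le_card_image_plus_collisions:
  assumes "finite Z"
  shows "2 * card Z \<le> 2 * card (g ` Z) + card {(x, y) \<in> Z \<times> Z. x \<noteq> y \<and> g x = g y}"
  using assms
proof (induction Z)
  case (insert a Z)
  let ?C = "\<lambda>Z. {(x, y) \<in> Z \<times> Z. x \<noteq> y \<and> g x = g y}"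
  have fin: "finite (?C (insert a Z))"
    by (rule finite_subset[of _ "insert a Z \<times> insert a Z"]) (use insert in auto)
  show ?case
  proof (cases "g a \<in> g ` Z")
    case True
    then obtain b where b: "b \<in> Z" "g a = g b" by blast
    have "card (?C Z) + 2 = card (insert (a, b) (insert (b, a) (?C Z)))"
    proof -
      define C where "C = ?C Z"
      have "finite C" unfolding C_def by (rule finite_subset[OF _ fin]) auto
      moreover have "(b, a) \<notin> C" "(a, b) \<notin> insert (b, a) C"
        using insert b by (auto simp: C_def)
      ultimately show ?thesis unfolding C_def[symmetric] by simp
    qed
    also have "\<dots> \<le> card (?C (insert a Z))"
      using insert b by (intro card_mono fin) auto
    finally show ?thesis using insert True by (simp add: insert_absorb)
  next
    case False
    have "card (?C Z) \<le> card (?C (insert a Z))"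
      by (intro card_mono fin) auto
    then show ?thesis using insert False by simp
  qed
qed simp

text \<open>Both conclusions are about pairs of distinct points whose difference is annihilated
  modulo \<open>p\<close>: equal residues concern all pairs, vanishing residues the pairs whose
  second point is the origin. A single weighted average therefore serves both.\<close>

lemma exists_sparsifying_residue_vector:
  fixes p :: int and Z :: "('n::finite \<Rightarrow> int) set"
  assumes "prime p" "finite Z" "(\<lambda>_. 0) \<in> Z"
    and large: "card Z > 1000" and p: "int (card Z) < p" "real_of_int p < 4 * real (card Z) / 3"
    and distinct: "\<And>x y. x \<in> Z \<Longrightarrow> y \<in> Z \<Longrightarrow> x \<noteq> y \<Longrightarrow> \<exists>i. \<not> p dvd x i - y i"
  obtains u :: "'n \<Rightarrow> int"
  where "card {z \<in> Z. p dvd (\<Sum>j\<in>UNIV. u j * z j)} \<le> 1000"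
    and "nat p + 2 \<le> 3 * card ((\<lambda>z. (\<Sum>j\<in>UNIV. u j * z j) mod p) ` Z)"
proof -
  let ?N = "card Z"
  let ?o = "\<lambda>_::'n. 0 :: int"
  define D where "D = {(x, y) \<in> Z \<times> Z. x \<noteq> y}"
  \<comment> \<open>Only \<open>N - 1\<close> of the \<open>N * (N - 1)\<close> pairs have second
    point 0, so these get the extra weight \<open>N\<close>. The total weight is
    \<open>999 * N * (N - 1) + N * (N - 1) = 1000 * N * (N - 1)\<close>.\<close>
  define c :: "('n \<Rightarrow> int) \<times> ('n \<Rightarrow> int) \<Rightarrow> real"
    where "c = (\<lambda>(x, y). 999 + (if y = ?o then real ?N else 0))"
  have finD: "finite D"
    unfolding D_def by (rule finite_subset[of _ "Z \<times> Z"]) (use assms in auto)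
  have "D = Z \<times> Z - (\<lambda>x. (x, x)) ` Z" by (auto simp: D_def)
  then have "card D = ?N * ?N - ?N"
    using assms(2) by (simp add: card_Diff_subset image_subset_iff card_image inj_on_def card_cartesian_product)
  then have cD: "real (card D) = real ?N * (real ?N - 1)"
    by (simp add: of_nat_diff algebra_simps)
  have sumD: "(\<Sum>k\<in>D. c k * of_bool (P k)) =
      999 * real (card {k \<in> D. P k}) + real ?N * real (card {x \<in> Z. x \<noteq> ?o \<and> P (x, ?o)})" for P
  proof -
    have "(\<Sum>k\<in>D. c k * of_bool (P k)) =
        (\<Sum>k\<in>D. 999 * of_bool (P k)) + (\<Sum>k\<in>D. real ?N * of_bool (snd k = ?o \<and> P k))"
      unfolding sum.distrib[symmetric] by (rule sum.cong) (auto simp: c_def)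
    also have "(\<Sum>k\<in>D. 999 * of_bool (P k)) = 999 * real (card {k \<in> D. P k})"
      using finD by (simp add: of_bool_def sum.If_cases Int_def if_distrib cong: if_cong)
    also have "(\<Sum>k\<in>D. real ?N * of_bool (snd k = ?o \<and> P k)) = real ?N * real (card {k \<in> D. snd k = ?o \<and> P k})"
      using finD by (simp add: of_bool_def sum.If_cases Int_def if_distrib cong: if_cong)
    also have "{k \<in> D. snd k = ?o \<and> P k} = (\<lambda>x. (x, ?o)) ` {x \<in> Z. x \<noteq> ?o \<and> P (x, ?o)}"
      using assms(3) by (auto simp: D_def)
    also have "card \<dots> = card {x \<in> Z. x \<noteq> ?o \<and> P (x, ?o)}"
      by (rule card_image) (auto simp: inj_on_def)
    finally show ?thesis .
  qed
  have "card {x \<in> Z. x \<noteq> ?o} = ?N - 1"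
    using assms(2,3) card_Diff_singleton[of ?o Z] by (simp add: set_diff_eq)
  then have sumc: "sum c D = 1000 * (real ?N * (real ?N - 1))"
    using sumD[of "\<lambda>_. True"] cD large by (simp add: of_nat_diff)
  have "\<exists>u. p * (\<Sum>k\<in>D. c k * of_bool (p dvd (\<Sum>j\<in>UNIV. u j * (fst k j - snd k j)))) \<le> sum c D"
    using distinct by (intro exists_residue_vector_few_orthogonal assms(1) finD) (auto simp: D_def c_def)
  then obtain u where
    u: "p * (\<Sum>k\<in>D. c k * of_bool (p dvd (\<Sum>j\<in>UNIV. u j * (fst k j - snd k j)))) \<le> sum c D" ..
  let ?f = "\<lambda>z. \<Sum>j\<in>UNIV. u j * z j"
  let ?g = "\<lambda>z. ?f z mod p"
  define C where "C = card {(x, y) \<in> Z \<times> Z. x \<noteq> y \<and> ?g x = ?g y}"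
  define X where "X = card {x \<in> Z. x \<noteq> ?o \<and> p dvd ?f x}"
  have "{k \<in> D. p dvd (\<Sum>j\<in>UNIV. u j * (fst k j - snd k j))} = {(x, y) \<in> Z \<times> Z. x \<noteq> y \<and> ?g x = ?g y}"
    by (auto simp: D_def mod_eq_dvd_iff sum_subtractf right_diff_distrib)
  then have main: "p * (999 * real C + real ?N * real X) \<le> 1000 * (real ?N * (real ?N - 1))"
    using u unfolding sumD sumc by (simp add: C_def X_def)
  have N: "real ?N > 0" "real ?N < p" using large p by linarith+
  \<comment> \<open>Discarding the collision term leaves at most 999 nonzero points; the origin
    completes the 1000.\<close>
  have "real ?N * (p * real X) \<le> p * (999 * real C + real ?N * real X)"
    using N by (simp add: algebra_simps)
  also have "\<dots> \<le> real ?N * (1000 * (real ?N - 1))" using main by (simp only: mult_ac)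
  finally have "p * real X \<le> 1000 * (real ?N - 1)" using N by simp
  also have "\<dots> < p * 1000" using N by simp
  finally have X: "X < 1000" using N by simp
  \<comment> \<open>Now the term in \<open>X\<close> is discarded, and \<open>N < p\<close> lets the
    factor \<open>p\<close> cancel.\<close>
  have "p * (999 * real C) \<le> p * (999 * real C + real ?N * real X)"
    using N by simp
  also have "\<dots> \<le> real ?N * (1000 * (real ?N - 1))" using main by (simp only: mult_ac)
  also have "\<dots> \<le> p * (1000 * (real ?N - 1))"
    using N large by (intro mult_right_mono) auto
  finally have C: "999 * real C \<le> 1000 * (real ?N - 1)" using N by simp
  have "{z \<in> Z. p dvd ?f z} \<subseteq> insert ?o {x \<in> Z. x \<noteq> ?o \<and> p dvd ?f x}" by auto
  then have "card {z \<in> Z. p dvd ?f z} \<le> card (insert ?o {x \<in> Z. x \<noteq> ?o \<and> p dvd ?f x})"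
    using assms(2) by (intro card_mono) auto
  also have "\<dots> \<le> 1000" using X assms(2) by (simp add: X_def)
  finally have 1: "card {z \<in> Z. p dvd ?f z} \<le> 1000" .
  have "2 * ?N \<le> 2 * card (?g ` Z) + C"
    unfolding C_def by (rule card_le_card_image_plus_collisions[OF assms(2)])
  then have "2 * real ?N \<le> 2 * real (card (?g ` Z)) + real C" by linarith
  moreover have "real (nat p) = real_of_int p" using p large by simp
  moreover have N1000: "real ?N > 1000" using large by simp
  \<comment> \<open>Three times the number of residues is at least
    \<open>3 * N - 1500 * (N - 1) / 999\<close>, roughly \<open>1.498 * N\<close>, which exceeds
    \<open>4 * N / 3 + 2\<close> once \<open>N > 1000\<close>.\<close>
  ultimately have "real (nat p) + 2 \<le> 3 * real (card (?g ` Z))"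
    using C p(2) N1000 by argo
  then have 2: "nat p + 2 \<le> 3 * card (?g ` Z)" by linarith
  show thesis using that 1 2 by blast
qed

section \<open>Symmetric convex bodies and packing\<close>

lemma symmetric_set_uminus:
  assumes "symmetric_set K" "x \<in> K"
  shows "- x \<in> K"
  using assms unfolding symmetric_set_def by (metis imageI)

lemma symmetric_convex_scaleR_mem:
  assumes "convex K" "symmetric_set K" "x \<in> K" "\<bar>c\<bar> \<le> 1"
  shows "c *\<^sub>R x \<in> K"
proof -
  have "((1 + c) / 2) *\<^sub>R x + ((1 - c) / 2) *\<^sub>R (- x) \<in> K"
    using assms symmetric_set_uminus by (intro convexD) (auto simp: field_simps)
  moreover have "((1 + c) / 2) *\<^sub>R x + ((1 - c) / 2) *\<^sub>R (- x) = c *\<^sub>R x"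
    by (simp add: scaleR_left_diff_distrib[symmetric] field_simps)
  ultimately show ?thesis by simp
qed

lemma convex_scaled_add_mem:
  assumes "convex K" "0 \<le> s" "0 \<le> t" "x \<in> (\<lambda>v. s *\<^sub>R v) ` K" "y \<in> (\<lambda>v. t *\<^sub>R v) ` K"
  shows "x + y \<in> (\<lambda>v. (s + t) *\<^sub>R v) ` K"
proof (cases "s + t = 0")
  case True
  then show ?thesis using assms by (force simp: add_nonneg_eq_0_iff)
next
  case False
  obtain a b where ab: "a \<in> K" "b \<in> K" "x = s *\<^sub>R a" "y = t *\<^sub>R b" using assms by blast
  have "(s / (s + t)) *\<^sub>R a + (t / (s + t)) *\<^sub>R b \<in> K"
    using assms ab False by (intro convexD) (auto simp: add_divide_distrib[symmetric])
  moreover have "x + y = (s + t) *\<^sub>R ((s / (s + t)) *\<^sub>R a + (t / (s + t)) *\<^sub>R b)"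
    using False by (simp add: ab scaleR_add_right)
  ultimately show ?thesis by blast
qed

lemma symmetric_scaled_uminus_mem:
  assumes "symmetric_set K" "x \<in> (\<lambda>v. t *\<^sub>R v) ` K"
  shows "- x \<in> (\<lambda>v. t *\<^sub>R v) ` K"
  using assms symmetric_set_uminus by (force simp: scaleR_minus_right[symmetric] simp del: scaleR_minus_right)

text \<open>Full dimension supplies an interior point \<open>x\<close>; by symmetry
  \<open>- x\<close> is interior as well, and 0 is their midpoint.\<close>

lemma symmetric_convex_body_0_interior:
  assumes "convex_body K" "symmetric_set K"
  shows "0 \<in> interior K"
proof -
  have K: "convex K" "aff_dim K = int DIM('a)" using assms(1) by (auto simp: convex_body_def)
  then have "K \<noteq> {}" by auto
  then have "interior K \<noteq> {}"
    using K interior_rel_interior_gen[of K] rel_interior_eq_empty[of K] by simp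
  then obtain x where x: "x \<in> interior K" by blast
  then have "- x \<in> interior (uminus ` K)" by (simp add: interior_negations)
  then have "- x \<in> interior K" using assms(2) by (simp add: symmetric_set_def)
  then have "(1/2) *\<^sub>R x + (1/2) *\<^sub>R (- x) \<in> interior K"
    using x K(1) by (intro convexD[OF convex_interior]) auto
  then show ?thesis by simp
qed

text \<open>Guards the infimum in \<open>norm_of_body\<close>, since \<open>Inf\<close> of the empty
  set of reals carries no information. A small ball inside \<open>K\<close> gives an admissible
  scale.\<close>

lemma norm_of_body_nonempty:
  fixes K :: "'a::euclidean_space set"
  assumes "0 \<in> interior K"
  shows "\<exists>s\<ge>0. x \<in> (\<lambda>v. s *\<^sub>R v) ` K"
proof -
  obtain e where e: "e > 0" "ball 0 e \<subseteq> K" using assms mem_interior by blast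
  define s where "s = (norm x + 1) / e"
  have s: "s > 0" using e by (simp add: s_def add_nonneg_pos)
  have "norm x < norm x + 1" by simp
  then have "norm ((1 / s) *\<^sub>R x) < e"
    using e s by (simp add: s_def divide_simps add_nonneg_pos)
  then have "(1 / s) *\<^sub>R x \<in> K" using e by auto
  moreover have "x = s *\<^sub>R ((1 / s) *\<^sub>R x)" using s by simp
  ultimately show ?thesis using s by (metis image_eqI less_imp_le)
qed

lemma norm_of_body_nonneg:
  fixes K :: "'a::euclidean_space set"
  assumes "0 \<in> interior K"
  shows "0 \<le> norm_of_body K x"
  unfolding norm_of_body_def using norm_of_body_nonempty[OF assms] by (intro cInf_greatest) auto

text \<open>A triangle inequality obtained without knowing that the infimum is attained: it is
  proved for each admissible scale \<open>s\<close> and then passed to the infimum.\<close>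

lemma norm_of_body_add_le:
  assumes "0 \<in> interior K" "convex K" "0 \<le> r" "a \<in> (\<lambda>v. r *\<^sub>R v) ` K"
  shows "norm_of_body K (x + a) \<le> norm_of_body K x + r"
proof -
  have "norm_of_body K (x + a) - r \<le> s" if "0 \<le> s" "x \<in> (\<lambda>v. s *\<^sub>R v) ` K" for s
  proof -
    have "norm_of_body K (x + a) \<le> s + r"
      unfolding norm_of_body_def using that assms
      by (intro cInf_lower) (auto intro: convex_scaled_add_mem bdd_belowI[of _ 0])
    then show ?thesis by simp
  qed
  then have "norm_of_body K (x + a) - r \<le> norm_of_body K x"
    unfolding norm_of_body_def[of K x] using norm_of_body_nonempty[OF assms(1)]
    by (intro cInf_greatest) auto
  then show ?thesis by simp
qed

lemma body_dist_le_add: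
  assumes "0 \<in> interior K" "convex K" "0 \<le> r" "L \<noteq> {}"
    and near: "\<And>y. y \<in> L \<Longrightarrow> \<exists>a \<in> (\<lambda>v. r *\<^sub>R v) ` K. y + a \<in> M"
  shows "body_dist K M x \<le> body_dist K L x + r"
proof -
  have "body_dist K M x - r \<le> norm_of_body K (y - x)" if y: "y \<in> L" for y
  proof -
    obtain a where a: "a \<in> (\<lambda>v. r *\<^sub>R v) ` K" "y + a \<in> M" using near[OF y] by blast
    have "body_dist K M x \<le> norm_of_body K ((y + a) - x)"
      unfolding body_dist_def using a norm_of_body_nonneg[OF assms(1)]
      by (intro cINF_lower) (auto intro: bdd_belowI[of _ 0])
    also have "\<dots> = norm_of_body K ((y - x) + a)" by (simp add: algebra_simps)
    also have "\<dots> \<le> norm_of_body K (y - x) + r"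
      using assms a by (intro norm_of_body_add_le)
    finally show ?thesis by simp
  qed
  then have "body_dist K M x - r \<le> body_dist K L x"
    unfolding body_dist_def[of K L] using assms(4) by (intro cINF_greatest)
  then show ?thesis by simp
qed

text \<open>The copies \<open>s + (t / 2) K\<close> for \<open>s\<close> in \<open>S\<close> are
  disjoint and lie in \<open>x + (r + 1 / 2) t K\<close>. Comparing volumes gives
  \<open>((r + 1 / 2) / (1 / 2)) ^ n = (2 * r + 1) ^ n\<close>. For \<open>t = 0\<close> the copies
  have no volume, and that case is treated separately.\<close>

lemma card_separated_in_translate_le:
  fixes K :: "'a::euclidean_space set"
  assumes K: "convex_body K" "symmetric_set K" and "0 \<le> r" "0 \<le> t"
    and S: "finite S" "S \<subseteq> (\<lambda>a. a + x) ` (\<lambda>v. (r * t) *\<^sub>R v) ` K"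
    and sep: "pairwise (\<lambda>s s'. s - s' \<notin> (\<lambda>v. t *\<^sub>R v) ` K) S"
  shows "real (card S) \<le> (2 * r + 1) ^ DIM('a)"
proof (cases "t = 0")
  case True
  then have "S \<subseteq> {x}" using S by auto
  then have "card S \<le> 1" using card_mono[of "{x}" S] by simp
  then have "real (card S) \<le> 1" by simp
  also have "1 \<le> (2 * r + 1) ^ DIM('a)" using assms by (intro one_le_power) auto
  finally show ?thesis .
next
  case False
  then have t: "t > 0" using assms by simp
  have cK: "convex K" "compact K" using K by (auto simp: convex_body_def)
  have "\<not> negligible K"
    using symmetric_convex_body_0_interior[OF K] negligible_convex_interior[OF cK(1)] by auto
  then have V: "measure lebesgue K > 0"
    using lmeasurable_compact[OF cK(2)] negligible_iff_measure zero_less_measure_iff by blast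
  define T where "T s = (\<lambda>v. (t / 2) *\<^sub>R v + s) ` K" for s
  define W where "W = (\<lambda>v. (r * t + t / 2) *\<^sub>R v + x) ` K"
  have meas: "(\<lambda>v. c *\<^sub>R v + d) ` K \<in> lmeasurable" for c d
    using cK by (intro lmeasurable_compact compact_continuous_image continuous_intros)
  have "T s \<inter> T s' = {}" if "s \<in> S" "s' \<in> S" "s \<noteq> s'" for s s'
  proof (rule ccontr)
    assume "T s \<inter> T s' \<noteq> {}"
    then obtain k k' where k: "k \<in> K" "k' \<in> K" "(t / 2) *\<^sub>R k + s = (t / 2) *\<^sub>R k' + s'"
      by (auto simp: T_def)
    \<comment> \<open>A common point of two copies would place \<open>s - s'\<close> in
      \<open>t K\<close>, against separation.\<close>
    have "(t / 2) *\<^sub>R k' + (t / 2) *\<^sub>R (- k) \<in> (\<lambda>v. (t / 2 + t / 2) *\<^sub>R v) ` K"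
      using k t cK symmetric_set_uminus[OF K(2)] by (intro convex_scaled_add_mem imageI) auto
    moreover have "(t / 2) *\<^sub>R k' + (t / 2) *\<^sub>R (- k) = s - s'"
      using k(3) by (simp add: algebra_simps)
    ultimately show False using sep that by (auto simp: pairwise_def)
  qed
  then have disj: "disjoint_family_on T S" by (auto simp: disjoint_family_on_def)
  have "T s \<subseteq> W" if s: "s \<in> S" for s
  proof
    fix y assume "y \<in> T s"
    then obtain k where k: "k \<in> K" "y = (t / 2) *\<^sub>R k + s" by (auto simp: T_def)
    obtain k0 where k0: "k0 \<in> K" "s = (r * t) *\<^sub>R k0 + x" using s S by auto
    have "(r * t) *\<^sub>R k0 + (t / 2) *\<^sub>R k \<in> (\<lambda>v. (r * t + t / 2) *\<^sub>R v) ` K"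
      using k k0 t assms cK by (intro convex_scaled_add_mem) auto
    moreover have "y = ((r * t) *\<^sub>R k0 + (t / 2) *\<^sub>R k) + x"
      by (simp add: k k0)
    ultimately show "y \<in> W" by (auto simp: W_def)
  qed
  then have "measure lebesgue (\<Union>(T ` S)) \<le> measure lebesgue W"
    using S meas by (intro measure_mono_fmeasurable) (auto simp: T_def W_def intro!: fmeasurableD)
  moreover have "measure lebesgue (\<Union>(T ` S)) = (\<Sum>s\<in>S. measure lebesgue (T s))"
    using S(1) disj fmeasurableD[OF meas] fmeasurableD2[OF meas]
    by (intro measure_finite_Union) (auto simp: T_def[abs_def])
  moreover have "measure lebesgue (T s) = (t / 2) ^ DIM('a) * measure lebesgue K" for s
    unfolding T_def using measure_lebesgue_affine[of "t / 2" s K] t by simp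
  moreover have "measure lebesgue W = (r * t + t / 2) ^ DIM('a) * measure lebesgue K"
    unfolding W_def using measure_lebesgue_affine[of "r * t + t / 2" x K] t assms by simp
  ultimately have "real (card S) * (t / 2) ^ DIM('a) \<le> (r * t + t / 2) ^ DIM('a)"
    using V by simp
  also have "r * t + t / 2 = (2 * r + 1) * (t / 2)" by (simp add: field_simps)
  finally have "real (card S) * (t / 2) ^ DIM('a) \<le> (2 * r + 1) ^ DIM('a) * (t / 2) ^ DIM('a)"
    by (simp only: power_mult_distrib)
  then show ?thesis using t by simp
qed

lemma card_translate_Int_le:
  fixes K :: "'a::euclidean_space set"
  assumes K: "convex_body K" "symmetric_set K" and t: "0 \<le> t"
    and diff: "\<And>x y. x \<in> M \<Longrightarrow> y \<in> M \<Longrightarrow> x - y \<in> M"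
    and fin: "\<And>A. bounded A \<Longrightarrow> finite (A \<inter> M)"
  defines "F \<equiv> \<lambda>x. (\<lambda>a. a + x) ` (\<lambda>v. (3 * t) *\<^sub>R v) ` K \<inter> M"
  shows "finite (F x)" and "card (F x) \<le> card ((\<lambda>v. t *\<^sub>R v) ` K \<inter> M) * 7 ^ DIM('a)"
proof -
  have cK: "convex K" "compact K" using K by (auto simp: convex_body_def)
  have zero: "0 \<in> (\<lambda>v. t *\<^sub>R v) ` K"
    using symmetric_convex_body_0_interior[OF K] interior_subset by force
  have "compact ((\<lambda>a. a + x) ` (\<lambda>v. (3 * t) *\<^sub>R v) ` K)"
    using cK by (intro compact_continuous_image continuous_intros)
  then show finF: "finite (F x)"
    unfolding F_def by (intro fin compact_imp_bounded)
  have "bounded ((\<lambda>v. t *\<^sub>R v) ` K)"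
    using cK by (intro compact_imp_bounded compact_continuous_image continuous_intros)
  then have fint: "finite ((\<lambda>v. t *\<^sub>R v) ` K \<inter> M)" by (rule fin)
  let ?sep = "pairwise (\<lambda>s s'. s - s' \<notin> (\<lambda>v. t *\<^sub>R v) ` K)"
  have "\<exists>S \<in> {S. S \<subseteq> F x \<and> ?sep S}. \<forall>S' \<in> {S. S \<subseteq> F x \<and> ?sep S}. S \<subseteq> S' \<longrightarrow> S = S'"
    using finF by (intro finite_has_maximal) (auto intro: exI[of _ "{}"])
  then obtain S where "S \<in> {S. S \<subseteq> F x \<and> ?sep S}"
    and *: "\<forall>S' \<in> {S. S \<subseteq> F x \<and> ?sep S}. S \<subseteq> S' \<longrightarrow> S = S'" by (rule bexE)
  then have S: "S \<subseteq> F x" "?sep S" by simp_all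
  have max: "S = S'" if "S' \<subseteq> F x" "?sep S'" "S \<subseteq> S'" for S'
    using bspec[OF *, of S'] that by simp
  have finS: "finite S" using S finF finite_subset by blast
  \<comment> \<open>The packing bound with \<open>r = 3\<close> is the source of the 7.\<close>
  have "real (card S) \<le> (2 * 3 + 1) ^ DIM('a)"
    using S by (intro card_separated_in_translate_le[OF K _ t finS]) (auto simp: F_def)
  then have "real (card S) \<le> real (7 ^ DIM('a))" by simp
  then have cS: "card S \<le> 7 ^ DIM('a)" by (simp only: of_nat_le_iff)
  have "F x \<subseteq> (\<Union>s\<in>S. (\<lambda>v. v + s) ` ((\<lambda>v. t *\<^sub>R v) ` K \<inter> M))"
  proof
    fix y assume y: "y \<in> F x"
    have "\<exists>s\<in>S. y - s \<in> (\<lambda>v. t *\<^sub>R v) ` K"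
    proof (rule ccontr)
      \<comment> \<open>Separation is required in both orders, hence the appeal to symmetry of
        \<open>K\<close>. Maximality then forces \<open>y\<close> into \<open>S\<close>, where
        \<open>y - y = 0\<close> contradicts \<open>far\<close>.\<close>
      assume far: "\<not> ?thesis"
      moreover have "s - y \<notin> (\<lambda>v. t *\<^sub>R v) ` K" if "s \<in> S" for s
        using far that symmetric_scaled_uminus_mem[OF K(2), of "s - y" t] by auto
      ultimately have "?sep (insert y S)"
        using S(2) by (simp add: pairwise_insert)
      then have "y \<in> S" using max[of "insert y S"] S(1) y by blast
      then show False using far zero by force
    qed
    then obtain s where s: "s \<in> S" "y - s \<in> (\<lambda>v. t *\<^sub>R v) ` K" by blast
    then have "y - s \<in> (\<lambda>v. t *\<^sub>R v) ` K \<inter> M"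
      using y S diff by (auto simp: F_def)
    moreover have "y = (y - s) + s" by simp
    ultimately show "y \<in> (\<Union>s\<in>S. (\<lambda>v. v + s) ` ((\<lambda>v. t *\<^sub>R v) ` K \<inter> M))"
      using s(1) by blast
  qed
  then have "card (F x) \<le> card (\<Union>s\<in>S. (\<lambda>v. v + s) ` ((\<lambda>v. t *\<^sub>R v) ` K \<inter> M))"
    using finS fint by (intro card_mono) auto
  also have "\<dots> \<le> (\<Sum>s\<in>S. card ((\<lambda>v. v + s) ` ((\<lambda>v. t *\<^sub>R v) ` K \<inter> M)))"
    by (rule card_UN_le[OF finS])
  also have "\<dots> \<le> (\<Sum>s\<in>S. card ((\<lambda>v. t *\<^sub>R v) ` K \<inter> M))"
    by (intro sum_mono card_image_le fint)
  also have "\<dots> = card ((\<lambda>v. t *\<^sub>R v) ` K \<inter> M) * card S" by simp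
  also have "\<dots> \<le> card ((\<lambda>v. t *\<^sub>R v) ` K \<inter> M) * 7 ^ DIM('a)"
    using cS by simp
  finally show "card (F x) \<le> card ((\<lambda>v. t *\<^sub>R v) ` K \<inter> M) * 7 ^ DIM('a)" .
qed

lemma max_translate_points_le:
  fixes K :: "'a::euclidean_space set"
  assumes "convex_body K" "symmetric_set K" "0 \<le> t"
    and "\<And>x y. x \<in> M \<Longrightarrow> y \<in> M \<Longrightarrow> x - y \<in> M"
    and "\<And>A. bounded A \<Longrightarrow> finite (A \<inter> M)"
    and m: "card ((\<lambda>v. t *\<^sub>R v) ` K \<inter> M) \<le> m"
  shows "max_translate_points ((\<lambda>v. (3 * t) *\<^sub>R v) ` K) M \<le> of_nat m * 7 ^ DIM('a)"
  unfolding max_translate_points_def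
proof (rule SUP_least)
  fix x
  let ?F = "(\<lambda>a. a + x) ` (\<lambda>v. (3 * t) *\<^sub>R v) ` K \<inter> M"
  have "finite ?F" "card ?F \<le> card ((\<lambda>v. t *\<^sub>R v) ` K \<inter> M) * 7 ^ DIM('a)"
    using card_translate_Int_le[OF assms(1-5)] by blast+
  moreover have "card ((\<lambda>v. t *\<^sub>R v) ` K \<inter> M) * 7 ^ DIM('a) \<le> m * 7 ^ DIM('a)"
    using m by simp
  ultimately have "finite ?F" "card ?F \<le> m * 7 ^ DIM('a)" by linarith+
  moreover have "of_nat m * 7 ^ DIM('a) = enat (m * 7 ^ DIM('a))"
    by (simp flip: of_nat_eq_enat)
  ultimately show "(let S = ?F in if finite S then enat (card S) else \<infinity>) \<le> of_nat m * 7 ^ DIM('a)"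
    by (simp add: Let_def)
qed

section \<open>Lattices and sparsification\<close>

text \<open>Coordinates are integer functions rather than real vectors with integral entries, so
  that divisibility by \<open>p\<close> can be handled over \<open>int\<close>.\<close>

definition lattice_point :: "real ^ 'n ^ 'n \<Rightarrow> ('n \<Rightarrow> int) \<Rightarrow> real ^ 'n" where
  "lattice_point B z = B *v (\<chi> i. of_int (z i))"

lemma full_lattice_iff_range_lattice_point:
  fixes L :: "(real ^ 'n) set"
  shows "full_lattice L \<longleftrightarrow> (\<exists>B. invertible B \<and> L = range (lattice_point B))"
proof -
  have "{z :: real ^ 'n. \<forall>i. z $ i \<in> \<int>} = range (\<lambda>z. \<chi> i. of_int (z i))"
  proof (intro equalityI subsetI)
    fix z :: "real ^ 'n" assume "z \<in> {z. \<forall>i. z $ i \<in> \<int>}"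
    then have "z = (\<chi> i. of_int \<lfloor>z $ i\<rfloor>)" by (auto simp: vec_eq_iff elim: Ints_cases)
    then show "z \<in> range (\<lambda>z. \<chi> i. of_int (z i))"
      by (rule range_eqI[where x = "\<lambda>i. \<lfloor>z $ i\<rfloor>"])
  qed auto
  then show ?thesis
    by (simp add: full_lattice_def lattice_point_def[abs_def] image_image)
qed

lemma lattice_point_add: "lattice_point B (\<lambda>i. x i + y i) = lattice_point B x + lattice_point B y"
  unfolding lattice_point_def matrix_vector_right_distrib[symmetric] by (simp add: vec_eq_iff plus_vec_def)

lemma lattice_point_diff: "lattice_point B (\<lambda>i. x i - y i) = lattice_point B x - lattice_point B y"
  unfolding lattice_point_def matrix_vector_mult_diff_distrib[symmetric] by (simp add: minus_vec_def)

lemma lattice_point_mult: "lattice_point B (\<lambda>i. k * x i) = of_int k *\<^sub>R lattice_point B x"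
proof -
  have "(\<chi> i. of_int (k * x i)) = (of_int k *\<^sub>R (\<chi> i. of_int (x i)) :: real ^ 'a)"
    by (simp add: vec_eq_iff)
  then show ?thesis by (simp add: lattice_point_def matrix_vector_mult_scaleR)
qed

lemma inj_lattice_point:
  assumes "invertible B"
  shows "inj (lattice_point B)"
proof (rule injI)
  fix x y assume eq: "lattice_point B x = lattice_point B y"
  obtain B' where "B' ** B = mat 1" using assms invertible_def by blast
  then have "(\<chi> i. of_int (z i)) = B' *v lattice_point B z" for z
    by (simp add: lattice_point_def matrix_vector_mul_assoc)
  then have "(\<chi> i. real_of_int (x i)) = (\<chi> i. of_int (y i))" using eq by metis
  then show "x = y" by (simp add: vec_eq_iff fun_eq_iff)
qed

lemma finite_lattice_point_vimage:
  assumes "invertible B" "bounded A"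
  shows "finite {z. lattice_point B z \<in> A}"
proof -
  obtain B' where B': "B' ** B = mat 1" using assms(1) unfolding invertible_def by blast
  have "bounded ((*v) B' ` A)"
    by (intro bounded_linear_image assms(2) matrix_vector_mul_bounded_linear)
  then obtain C where C: "\<And>y. y \<in> A \<Longrightarrow> norm (B' *v y) \<le> C"
    unfolding bounded_iff by auto
  have "{z. lattice_point B z \<in> A} \<subseteq> PiE UNIV (\<lambda>_. {- \<lceil>C\<rceil>..\<lceil>C\<rceil>})"
  proof
    fix z assume "z \<in> {z. lattice_point B z \<in> A}"
    then have "norm (B' *v lattice_point B z) \<le> C" using C by simp
    moreover have "B' *v lattice_point B z = (\<chi> i. of_int (z i))"
      by (simp add: lattice_point_def matrix_vector_mul_assoc B')
    ultimately have "\<bar>real_of_int (z i)\<bar> \<le> C" for i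
      using component_le_norm_cart[of "\<chi> i. real_of_int (z i)" i] by simp
    then have abs: "\<bar>z i\<bar> \<le> \<lceil>C\<rceil>" for i
      by (metis ceiling_mono ceiling_of_int of_int_abs)
    have "z i \<in> {- \<lceil>C\<rceil>..\<lceil>C\<rceil>}" for i
      using abs[of i] by (auto simp: abs_le_iff)
    then show "z \<in> PiE UNIV (\<lambda>_. {- \<lceil>C\<rceil>..\<lceil>C\<rceil>})" by auto
  qed
  then show ?thesis by (rule finite_subset) (intro finite_PiE, auto)
qed

text \<open>The witness is the inverse transpose of \<open>B\<close> applied to \<open>u\<close>. It
  turns an integer linear form on coordinates into the inner product with a dual vector.\<close>

lemma exists_inner_lattice_point:
  assumes "invertible B"
  obtains w where "\<And>z. w \<bullet> lattice_point B z = of_int (\<Sum>j\<in>UNIV. u j * z j)"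
proof -
  obtain B' where B': "B' ** B = mat 1" using assms invertible_def by blast
  have "((\<chi> i. real_of_int (u i)) v* B') \<bullet> lattice_point B z = of_int (\<Sum>j\<in>UNIV. u j * z j)" for z
    unfolding dot_lmul_matrix
    by (simp add: lattice_point_def matrix_vector_mul_assoc B' inner_vec_def)
  then show thesis by (rule that)
qed

text \<open>If \<open>x - y = p v\<close>, then the \<open>p\<close> multiples \<open>k v\<close> with \<open>\<bar>k\<bar> \<le> (p - 1) / 2\<close> would all lie in \<open>t K\<close>.\<close>

lemma lattice_points_in_body_distinct_mod:
  fixes K :: "(real ^ 'n) set" and B :: "real ^ 'n ^ 'n" and p :: int
  assumes "convex K" "symmetric_set K" "0 \<le> t"
  defines "Z \<equiv> {z. lattice_point B z \<in> (\<lambda>v. t *\<^sub>R v) ` K}"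
  assumes "finite Z" "odd p" "int (card Z) < p" "x \<in> Z" "y \<in> Z" "x \<noteq> y"
  shows "\<exists>i. \<not> p dvd x i - y i"
proof (rule ccontr)
  assume "\<not> ?thesis"
  then have dvd: "p dvd x i - y i" for i by blast
  define v where "v i = (x i - y i) div p" for i
  have v: "x i - y i = p * v i" for i using dvd by (simp add: v_def)
  obtain i where i: "x i \<noteq> y i" using assms(10) by blast
  then have vi: "v i \<noteq> 0" using v[of i] by auto
  have p: "p > 0" using assms(7) by linarith
  \<comment> \<open>The difference lies only in \<open>2 t K\<close>; restricting to multiples
    \<open>k\<close> with \<open>2 * \<bar>k\<bar> \<le> p\<close> below makes up for the factor
    2.\<close>
  have "lattice_point B x + - lattice_point B y \<in> (\<lambda>v. (t + t) *\<^sub>R v) ` K"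
    using assms(8,9) by (intro convex_scaled_add_mem symmetric_scaled_uminus_mem assms(1-3)) (auto simp: Z_def)
  then obtain a where a: "a \<in> K" "lattice_point B x - lattice_point B y = (t + t) *\<^sub>R a" by auto
  have "lattice_point B x - lattice_point B y = of_int p *\<^sub>R lattice_point B v"
    unfolding lattice_point_diff[symmetric] lattice_point_mult[symmetric] v ..
  then have pv: "of_int p *\<^sub>R lattice_point B v = (2 * t) *\<^sub>R a" using a(2) by simp
  have lv: "lattice_point B v = (2 * t / p) *\<^sub>R a"
  proof -
    have "lattice_point B v = (1 / p) *\<^sub>R (of_int p *\<^sub>R lattice_point B v)" using p by simp
    then show ?thesis unfolding pv by simp
  qed
  \<comment> \<open>As \<open>p\<close> is odd, \<open>{-m..m}\<close> has exactly \<open>p\<close>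
    elements, one too many for \<open>card Z < p\<close>.\<close>
  define m where "m = (p - 1) div 2"
  have m: "p = 2 * m + 1" using assms(6) by (auto simp: m_def elim: oddE)
  have "(\<lambda>j. k * v j) \<in> Z" if "k \<in> {-m..m}" for k
  proof -
    have "\<bar>2 * k\<bar> \<le> p" using that m by auto
    then have "real_of_int \<bar>2 * k\<bar> \<le> real_of_int p" by (simp only: of_int_le_iff)
    then have "\<bar>2 * k / p\<bar> \<le> (1::real)" using p by (simp add: field_simps abs_mult)
    then have "(2 * k / p) *\<^sub>R a \<in> K"
      using symmetric_convex_scaleR_mem[OF assms(1,2) a(1)] by blast
    moreover have "lattice_point B (\<lambda>j. k * v j) = t *\<^sub>R ((2 * k / p) *\<^sub>R a)"
      unfolding lattice_point_mult lv by (simp add: mult_ac)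
    ultimately show ?thesis unfolding Z_def by blast
  qed
  then have "(\<lambda>k j. k * v j) ` {-m..m} \<subseteq> Z" by blast
  moreover have "inj_on (\<lambda>k j. k * v j) {-m..m}"
    using vi by (auto intro!: inj_onI dest!: fun_cong[of _ _ i])
  ultimately have "card {-m..m} \<le> card Z"
    using assms(5) card_inj_on_le by blast
  then show False using m assms(7) p by simp
qed

theorem theorem4p4:
  fixes K L :: "(real ^ 'n) set" and t :: real and N p :: nat
  assumes "convex_body K" and "symmetric_set K"
    and "full_lattice L"
    and "0 \<le> t"
    and "N = card ((\<lambda>v. t *\<^sub>R v) ` K \<inter> L)"
    and "prime p"
    and "N > 1000 \<Longrightarrow> N < p \<and> real p < 4 * real N / 3"
    and "\<not> N > 1000 \<Longrightarrow> p = 3"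
  shows "\<exists>w \<in> dual_lattice L.
           (\<forall>x. body_dist K (congruence_sublattice p L w) x \<le> body_dist K L x + 3 * t) \<and>
           max_translate_points ((\<lambda>v. (3 * t) *\<^sub>R v) ` K) (congruence_sublattice p L w)
             \<le> 1000 * 7 ^ CARD('n)"
proof -
  let ?tK = "(\<lambda>v. t *\<^sub>R v) ` K"
  obtain B where B: "invertible B" and L: "L = range (lattice_point B)"
    using assms(3) full_lattice_iff_range_lattice_point by blast
  have K: "convex K" "compact K" using assms(1) by (auto simp: convex_body_def)
  have zero: "0 \<in> interior K" by (rule symmetric_convex_body_0_interior[OF assms(1,2)])
  have diff: "x - y \<in> L" if "x \<in> L" "y \<in> L" for x y
    using that unfolding L by (auto simp: lattice_point_diff[symmetric])
  have fin: "finite (A \<inter> L)" if "bounded A" for A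
  proof -
    have "A \<inter> L \<subseteq> lattice_point B ` {z. lattice_point B z \<in> A}" unfolding L by blast
    then show ?thesis
      using finite_lattice_point_vimage[OF B that] by (meson finite_imageI finite_subset)
  qed
  have finM: "finite (A \<inter> congruence_sublattice p L w)" if "bounded A" for A w
    using fin[OF that] by (rule finite_subset[rotated]) (auto simp: congruence_sublattice_def)
  have diffM: "x - y \<in> congruence_sublattice p L w"
    if x: "x \<in> congruence_sublattice p L w" and y: "y \<in> congruence_sublattice p L w" for x y w
  proof -
    obtain k where "w \<bullet> x = of_int k" "[k = 0] (mod int p)"
      using x unfolding congruence_sublattice_def by blast
    moreover obtain l where "w \<bullet> y = of_int l" "[l = 0] (mod int p)"
      using y unfolding congruence_sublattice_def by blast
    ultimately have "w \<bullet> (x - y) = of_int (k - l)" "[k - l = 0] (mod int p)"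
      by (auto simp: inner_diff_right cong_0_iff)
    then show ?thesis using that diff by (auto simp: congruence_sublattice_def intro!: exI[of _ "k - l"])
  qed
  \<comment> \<open>This reduces (2), for any \<open>w\<close>, to counting the points of the
    sublattice in \<open>t K\<close>.\<close>
  have G: "max_translate_points ((\<lambda>v. (3 * t) *\<^sub>R v) ` K) (congruence_sublattice p L w) \<le> 1000 * 7 ^ CARD('n)"
    if "card (?tK \<inter> congruence_sublattice p L w) \<le> 1000" for w
    using max_translate_points_le[OF assms(1,2,4) diffM finM that] by simp
  show ?thesis
  proof (cases "N > 1000")
    case False
    \<comment> \<open>For \<open>w = 0\<close> nothing is removed, so (1) follows from
      \<open>t \<ge> 0\<close> and the count in \<open>G\<close> is \<open>N\<close> itself.\<close>
    have "congruence_sublattice p L 0 = L"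
      by (auto simp: congruence_sublattice_def intro!: exI[of _ 0])
    moreover have "0 \<in> dual_lattice L" by (simp add: dual_lattice_def)
    ultimately show ?thesis
      using G[of 0] False assms(4,5) by (intro bexI[of _ 0]) auto
  next
    case True
    define Z where "Z = {z. lattice_point B z \<in> ?tK}"
    have "bounded ?tK"
      using K by (intro compact_imp_bounded compact_continuous_image continuous_intros)
    then have finZ: "finite Z" unfolding Z_def by (rule finite_lattice_point_vimage[OF B])
    have tKL: "?tK \<inter> L = lattice_point B ` Z" unfolding Z_def L image_vimage_eq[symmetric] vimage_def ..
    then have cZ: "card Z = N"
      using assms(5) inj_lattice_point[OF B] by (simp add: card_image inj_on_subset)
    have p: "prime (int p)" "int (card Z) < int p" "real_of_int (int p) < 4 * real (card Z) / 3"
      using assms(6,7) True cZ by auto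
    have "odd (int p)" using p(2) cZ True assms(6) prime_odd_nat[of p] by simp
    then have distinct: "\<exists>i. \<not> int p dvd x i - y i" if "x \<in> Z" "y \<in> Z" "x \<noteq> y" for x y
      using lattice_points_in_body_distinct_mod[OF K(1) assms(2,4), of B "int p" x y] finZ p(2) that
      by (auto simp: Z_def)
    have lp0: "lattice_point B (\<lambda>_. 0) = 0" by (simp add: lattice_point_def zero_vec_def[symmetric])
    have "0 \<in> ?tK" using zero interior_subset by force
    then have "(\<lambda>_. 0) \<in> Z" by (simp add: Z_def lp0)
    then obtain u :: "'n \<Rightarrow> int" where
      u1: "card {z \<in> Z. int p dvd (\<Sum>j\<in>UNIV. u j * z j)} \<le> 1000" and
      u2: "nat (int p) + 2 \<le> 3 * card ((\<lambda>z. (\<Sum>j\<in>UNIV. u j * z j) mod int p) ` Z)"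
      using exists_sparsifying_residue_vector[OF p(1) finZ _ _ p(2,3) distinct] True cZ by blast
    let ?f = "\<lambda>z. \<Sum>j\<in>UNIV. u j * z j"
    obtain w where w: "\<And>z. w \<bullet> lattice_point B z = of_int (?f z)"
      using exists_inner_lattice_point[OF B, of u] by blast
    have mem: "lattice_point B z \<in> congruence_sublattice p L w \<longleftrightarrow> int p dvd ?f z" for z
      unfolding congruence_sublattice_def by (auto simp: w L cong_0_iff simp del: of_int_sum)
    have "w \<in> dual_lattice L"
      unfolding dual_lattice_def L by (auto simp: inner_commute[of _ w] w simp del: of_int_sum)
    moreover have "body_dist K (congruence_sublattice p L w) x \<le> body_dist K L x + 3 * t" for x
    proof (rule body_dist_le_add[OF zero K(1)])
      fix y assume "y \<in> L"
      then obtain z where z: "y = lattice_point B z" by (auto simp: L)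
      have "(\<lambda>z. ?f z mod int p) ` Z \<subseteq> {0..<int p}" using p by auto
      \<comment> \<open>The target residue is \<open>- ?f z\<close>, so that adding the three points
        to \<open>z\<close> makes the linear form vanish modulo \<open>p\<close>.\<close>
      then obtain a b c where abc: "a \<in> Z" "b \<in> Z" "c \<in> Z"
        "(?f a mod int p + ?f b mod int p + ?f c mod int p) mod int p = (- ?f z) mod int p"
        using triple_sumset_residues[OF p(1) _ u2, of "- ?f z"] by blast
      let ?s = "\<lambda>i. a i + b i + c i"
      have "(?f a + ?f b + ?f c) mod int p = (- ?f z) mod int p"
        unfolding abc(4)[symmetric] by (intro mod_add_cong mod_mod_trivial[symmetric])
      then have "int p dvd (?f a + ?f b + ?f c) - (- ?f z)"
        by (simp only: mod_eq_dvd_iff)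
      also have "(?f a + ?f b + ?f c) - (- ?f z) = ?f (\<lambda>i. z i + ?s i)"
        by (simp add: sum.distrib algebra_simps)
      finally have "lattice_point B (\<lambda>i. z i + ?s i) \<in> congruence_sublattice p L w"
        by (simp only: mem)
      then have "y + lattice_point B ?s \<in> congruence_sublattice p L w"
        by (simp only: lattice_point_add z)
      moreover have "lattice_point B a + lattice_point B b + lattice_point B c \<in> (\<lambda>v. (t + t + t) *\<^sub>R v) ` K"
        using abc K(1) assms(4) by (intro convex_scaled_add_mem) (auto simp: Z_def)
      then have "lattice_point B ?s \<in> (\<lambda>v. (3 * t) *\<^sub>R v) ` K"
        unfolding lattice_point_add by (simp add: algebra_simps)
      ultimately show "\<exists>a \<in> (\<lambda>v. (3 * t) *\<^sub>R v) ` K. y + a \<in> congruence_sublattice p L w" by blast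
    qed (use assms(4) L in auto)
    moreover have "?tK \<inter> congruence_sublattice p L w = lattice_point B ` {z \<in> Z. int p dvd ?f z}"
    proof -
      have "?tK \<inter> congruence_sublattice p L w = (?tK \<inter> L) \<inter> congruence_sublattice p L w"
        by (auto simp: congruence_sublattice_def)
      also have "\<dots> = lattice_point B ` {z \<in> Z. int p dvd ?f z}"
        unfolding tKL by (auto simp: mem simp del: image_iff)
      finally show ?thesis .
    qed
    then have "card (?tK \<inter> congruence_sublattice p L w) \<le> 1000"
      using u1 finZ card_image_le[of "{z \<in> Z. int p dvd ?f z}" "lattice_point B"] by simp
    ultimately show ?thesis using G by blast
  qed
qed

end
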